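(* If $(T,Tw)$ is a prime pair with $w$ a sign consistent edge path (in an associahedron) starting at $T$, then there is a unique normal coloring for $T$ compatible with $\Sigma(w)$ with the sign of $\emptyset$ positive.
   Context: **Trees.** $\mathcal T$ is the infinite binary tree whose vertices are a root $*$ and all finite words over $\{0,1\}$ (including the empty word $\emptyset$). The only child of $*$ is $\emptyset$; the word $u$ has left child $u0$ and right child $u1$. A finite binary tree is a finite subtree of $\mathcal T$ containing $*$ and $\emptyset$, closed under taking prefixes, in which $u0$ is a vertex iff $u1$ is. Leaves are the vertices without children, numbered from left to right; internal vertices are the words in the tree that are not leaves. The root edge joins $*$ to $\emptyset$. **Rotations.** For $u\in\{0,1\}^*$, the rotation $\lceil u\rfloor$ is the permutation of the vertices of $\mathcal T$ (acting on the right) given by $u00w\mapsto u0w$, $u01w\mapsto u10w$, $u1w\mapsto u11w$ for all $w\in\{0,1\}^*$, $u0\mapsto u$, $u\mapsto u1$, and fixing every other vertex. The symbol $\overline u$ is formal and $\lceil\overline u\rfloor=\lceil u\rfloor^{-1}$. The pivot vertices of $\lceil u\rfloor$ are $u$ and $u0$; those of $\lceil\overline u\rfloor$ are $u$ and $u1$. If both pivot vertices of $\lceil v\rfloor$ are internal vertices of a finite binary tree $T$, then $\lceil v\rfloor$ applies to $T$, and $T\lceil v\rfloor$ is the finite binary tree whose vertex set is the image of that of $T$. **Associahedron.** The vertices of the $d$-dimensional associahedron $A_d$ are the finite binary trees with $d+2$ leaves; edges correspond to rotations. An edge path starting at a tree $T$ is a word $w=\lceil v_1\rfloor\cdots\lceil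 v_k\rfloor$ (each $v_i$ of the form $u$ or $\overline u$) such that each $\lceil v_i\rfloor$ applies to $T\lceil v_1\rfloor\cdots\lceil v_{i-1}\rfloor$; its endpoint is $Tw$. **The signed graph $\Sigma(w)$.** Put $p_0=\mathrm{id}$ and $p_i=\lceil v_1\rfloor\cdots\lceil v_i\rfloor$ (permutations act on the right, composed left to right). $\Sigma_0$ has no edges. $\Sigma_i$ is obtained from $\Sigma_{i-1}$ by adding one edge $e_i$ (parallel edges allowed) joining $s=(x)p_{i-1}^{-1}$ and $t=(y)p_{i-1}^{-1}$, where $x,y$ are the pivot vertices of $\lceil v_i\rfloor$; $e_i$ is positive iff the sum of the degrees of $s$ and $t$ in $\Sigma_{i-1}$ is even. $\Sigma(w)=\Sigma_k$; all endpoints of its edges are internal vertices of $T$. The path $w$ is sign consistent if $\Sigma(w)$ is balanced: every closed walk traverses an even number of negative edges. **Prime pairs.** A finite binary tree with $n\ge 2$ leaves is dual to a triangulation (with no extra vertices) of an $(n+1)$-gon, the boundary edges corresponding in cyclic order to the root and the leaves in left-right order. A pair $(D,R)$ of trees with the same number $n\geq 2$ of leaves is prime if the graph on $S^2$ obtained by gluing the two dual triangulated polygons along their common boundary has no parallel edges, i.e. the two triangulations have no common diagonal. Equivalently: there are no internal vertices $a\neq\emptyset$ of $D$ and $b\ne\emptyset$ of $R$ such that the set of leaf numbers of leaves of $D$ below $a$ equals that of leaves of $R$ below $b$. **Colorings.** Colors are elements of $\mathbb Z_2\times\mathbb Z_2$, coded $0=(0,0)$, $1=(0,1)$, $2=(1,0)$,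 $3=(1,1)$. A coloring of $T$ is a proper edge coloring with colors $1,2,3$ (so the three edges at each internal vertex have distinct colors). Its derived sign assignment gives an internal vertex the sign $+$ if the colors of its (parent edge, left child edge, right child edge) form a cyclic permutation of $(1,2,3)$, and $-$ otherwise. A coloring is normal if the root edge has color $1$. A coloring of $T$ is compatible with $\Sigma(w)$ if every edge of $\Sigma(w)$ is positive if and only if it joins two internal vertices of $T$ whose derived signs are equal. *)

theory Defs
  imports Main "HOL-Library.Sublist" "HOL-Library.Z2" "HOL-Library.FuncSet"
begin

section \<open>Finite binary trees\<close>

text \<open>Letters are coded as \<open>False\<close> for \<open>0\<close> (left) and \<open>True\<close> for \<open>1\<close> (right).\<close>

type_synonym word = "bool list"

datatype vertex = Star | W word

definition finite_binary_tree :: "vertex set \<Rightarrow> bool" where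
  "finite_binary_tree T \<longleftrightarrow>
     finite T \<and> Star \<in> T \<and> W [] \<in> T \<and>
     (\<forall>u v. W (u @ v) \<in> T \<longrightarrow> W u \<in> T) \<and>
     (\<forall>u. W (u @ [False]) \<in> T \<longleftrightarrow> W (u @ [True]) \<in> T)"

definition leaves :: "vertex set \<Rightarrow> word set" where
  "leaves T = {u. W u \<in> T \<and> W (u @ [False]) \<notin> T \<and> W (u @ [True]) \<notin> T}"

definition internal :: "vertex set \<Rightarrow> word set" where
  "internal T = {u. W u \<in> T} - leaves T"

definition left_of :: "word \<Rightarrow> word \<Rightarrow> bool" where
  "left_of u v \<longleftrightarrow> (\<exists>p x y. u = p @ False # x \<and> v = p @ True # y)"

definition leaf_number :: "vertex set \<Rightarrow> word \<Rightarrow> nat" where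
  "leaf_number T v = Suc (card {u \<in> leaves T. left_of u v})"


section \<open>Rotations\<close>

fun rotate_suffix :: "word \<Rightarrow> word" where
  "rotate_suffix [] = [True]"
| "rotate_suffix [False] = []"
| "rotate_suffix (False # False # w) = False # w"
| "rotate_suffix (False # True # w) = True # False # w"
| "rotate_suffix (True # w) = True # True # w"

fun rotation_at :: "word \<Rightarrow> vertex \<Rightarrow> vertex" where
  "rotation_at u Star = Star"
| "rotation_at u (W v) =
     (if prefix u v then W (u @ rotate_suffix (drop (length u) v)) else W v)"

text \<open>\<open>Fwd u\<close> and \<open>Bwd u\<close> are the symbols \<open>u\<close> and \<open>u\<close> overlined.\<close>

datatype rotation = Fwd word | Bwd word

fun rot_perm :: "rotation \<Rightarrow> vertex \<Rightarrow> vertex" where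
  "rot_perm (Fwd u) = rotation_at u"
| "rot_perm (Bwd u) = inv (rotation_at u)"

fun pivots :: "rotation \<Rightarrow> word \<times> word" where
  "pivots (Fwd u) = (u, u @ [False])"
| "pivots (Bwd u) = (u, u @ [True])"

definition applies :: "rotation \<Rightarrow> vertex set \<Rightarrow> bool" where
  "applies r T \<longleftrightarrow> fst (pivots r) \<in> internal T \<and> snd (pivots r) \<in> internal T"

definition rotate_tree :: "vertex set \<Rightarrow> rotation \<Rightarrow> vertex set" where
  "rotate_tree T r = rot_perm r ` T"

lemma rotation_at_simps:
  "rotation_at u (W (u @ [False, False] @ w)) = W (u @ [False] @ w)"
  "rotation_at u (W (u @ [False, True] @ w)) = W (u @ [True, False] @ w)"
  "rotation_at u (W (u @ [True] @ w)) = W (u @ [True, True] @ w)"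
  "rotation_at u (W (u @ [False])) = W u"
  "rotation_at u (W u) = W (u @ [True])"
  by simp_all

lemma inj_rotate_suffix: "rotate_suffix x = rotate_suffix y \<Longrightarrow> x = y"
  by (cases x rule: rotate_suffix.cases; cases y rule: rotate_suffix.cases) auto

lemma surj_rotate_suffix: "\<exists>x. rotate_suffix x = y"
proof (cases y)
  case Nil
  then show ?thesis by (intro exI[of _ "[False]"]) simp
next
  case (Cons b z)
  show ?thesis
  proof (cases b)
    case False
    then show ?thesis using Cons by (intro exI[of _ "False # False # z"]) simp
  next
    case True
    note b = this
    show ?thesis
    proof (cases z)
      case Nil
      then show ?thesis using Cons b by (intro exI[of _ "[]"]) simp
    next
      case (Cons d z')
      then show ?thesis using \<open>y = b # z\<close> b
        by (cases d)
          (auto intro: exI[of _ "True # z'"] exI[of _ "False # True # z'"])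
    qed
  qed
qed

lemma bij_rotation_at: "bij (rotation_at u)"
proof (rule bijI)
  show "inj (rotation_at u)"
  proof (rule injI)
    fix x y assume "rotation_at u x = rotation_at u y"
    then show "x = y"
      by (cases x; cases y)
        (auto simp: prefix_def split: if_splits dest: inj_rotate_suffix)
  qed
  show "surj (rotation_at u)"
  proof (unfold surj_def, rule allI)
    fix y
    show "\<exists>x. y = rotation_at u x"
    proof (cases y)
      case Star
      then show ?thesis by (intro exI[of _ Star]) simp
    next
      case (W v)
      show ?thesis
      proof (cases "prefix u v")
        case True
        then obtain z where z: "v = u @ z" by (auto simp: prefix_def)
        obtain x where "rotate_suffix x = z" using surj_rotate_suffix by blast
        then show ?thesis using W z by (intro exI[of _ "W (u @ x)"]) simp
      next
        case False
        then show ?thesis using W by (intro exI[of _ "W v"]) simp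
      qed
    qed
  qed
qed


section \<open>Edge paths in the associahedra\<close>

definition associahedron_vertices :: "nat \<Rightarrow> vertex set set" where
  "associahedron_vertices d = {T. finite_binary_tree T \<and> card (leaves T) = d + 2}"

definition endpoint :: "vertex set \<Rightarrow> rotation list \<Rightarrow> vertex set" where
  "endpoint T w = foldl rotate_tree T w"

definition edge_path :: "nat \<Rightarrow> vertex set \<Rightarrow> rotation list \<Rightarrow> bool" where
  "edge_path d T w \<longleftrightarrow>
     T \<in> associahedron_vertices d \<and>
     (\<forall>i < length w. applies (w ! i) (endpoint T (take i w)))"


section \<open>The signed graph of a path\<close>

text \<open>
  A signed multigraph is the list of its edges. Rotations are permutations and the two
  pivot vertices differ, so no edge below is a loop and \<open>ends e\<close> has two elements.
\<close>

datatype signed_edge = Edge (ends: "vertex set") (positive: bool)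

definition degree :: "signed_edge list \<Rightarrow> vertex \<Rightarrow> nat" where
  "degree G x = length (filter (\<lambda>e. x \<in> ends e) G)"

text \<open>Products of rotations act on the right, hence the order of composition.\<close>

definition path_perm :: "rotation list \<Rightarrow> vertex \<Rightarrow> vertex" where
  "path_perm w = foldl (\<lambda>p r. rot_perm r \<circ> p) id w"

definition new_edge ::
    "signed_edge list \<Rightarrow> (vertex \<Rightarrow> vertex) \<Rightarrow> rotation \<Rightarrow> signed_edge" where
  "new_edge G p r =
     (let s = inv p (W (fst (pivots r)));
          t = inv p (W (snd (pivots r)))
      in Edge {s, t} (even (degree G s + degree G t)))"

fun sigma_upto :: "rotation list \<Rightarrow> nat \<Rightarrow> signed_edge list" where
  "sigma_upto w 0 = []"
| "sigma_upto w (Suc i) =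
     sigma_upto w i @ [new_edge (sigma_upto w i) (path_perm (take i w)) (w ! i)]"

definition sigma :: "rotation list \<Rightarrow> signed_edge list" where
  "sigma w = sigma_upto w (length w)"

inductive walk :: "signed_edge list \<Rightarrow> vertex \<Rightarrow> signed_edge list \<Rightarrow> vertex \<Rightarrow> bool"
  for G where
  walk_Nil: "walk G x [] x"
| walk_Cons: "e \<in> set G \<Longrightarrow> ends e = {x, y} \<Longrightarrow> walk G y es z \<Longrightarrow> walk G x (e # es) z"

definition balanced :: "signed_edge list \<Rightarrow> bool" where
  "balanced G \<longleftrightarrow>
     (\<forall>x es. walk G x es x \<longrightarrow> even (length (filter (\<lambda>e. \<not> positive e) es)))"

definition sign_consistent :: "rotation list \<Rightarrow> bool" where
  "sign_consistent w \<longleftrightarrow> balanced (sigma w)"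


section \<open>Prime pairs\<close>

text \<open>
  The corners of the polygon dual to a tree with \<open>n\<close> leaves are \<open>0, \<dots>, n\<close>: the boundary
  edge of leaf \<open>i\<close> joins \<open>i - 1\<close> and \<open>i\<close>, that of the root joins \<open>0\<close> and \<open>n\<close>. The tree edge
  above \<open>a\<close> separates the leaves below \<open>a\<close>, which are numbered consecutively \<open>i, \<dots>, j\<close>,
  from the other leaves and the root; its dual joins the corners \<open>i - 1\<close> and \<open>j\<close>. It is a
  diagonal exactly if \<open>a\<close> is an internal vertex other than the empty word.
\<close>

definition leaf_numbers_below :: "vertex set \<Rightarrow> word \<Rightarrow> nat set" where
  "leaf_numbers_below T a = leaf_number T ` {u \<in> leaves T. prefix a u}"

definition dual_edge :: "vertex set \<Rightarrow> word \<Rightarrow> nat set" where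
  "dual_edge T a = {Min (leaf_numbers_below T a) - 1, Max (leaf_numbers_below T a)}"

definition diagonals :: "vertex set \<Rightarrow> nat set set" where
  "diagonals T = dual_edge T ` (internal T - {[]})"

definition prime_pair :: "vertex set \<Rightarrow> vertex set \<Rightarrow> bool" where
  "prime_pair D R \<longleftrightarrow>
     finite_binary_tree D \<and> finite_binary_tree R \<and>
     card (leaves D) = card (leaves R) \<and> card (leaves D) \<ge> 2 \<and>
     diagonals D \<inter> diagonals R = {}"

text \<open>
  No common diagonal means that no two inner tree edges cut off the same leaf numbers.
\<close>

lemma left_of_trans: "left_of u v \<Longrightarrow> left_of v w \<Longrightarrow> left_of u w"
proof -
  assume "left_of u v" "left_of v w"
  then obtain p x y q x' y' where u: "u = p @ False # x" and v: "v = p @ True # y"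
    and v': "v = q @ False # x'" and w: "w = q @ True # y'"
    unfolding left_of_def by blast
  from v v' have "p @ True # y = q @ False # x'" by simp
  then consider s where "p = q @ s" "s @ True # y = False # x'"
    | s where "q = p @ s" "True # y = s @ False # x'"
    by (auto simp: append_eq_append_conv2)
  then show ?thesis
  proof cases
    case 1
    then obtain s' where "s = False # s'" by (cases s) auto
    then have "u = q @ False # (s' @ False # x)" using 1 u by simp
    then show ?thesis using w unfolding left_of_def by blast
  next
    case 2
    then obtain s' where "s = True # s'" by (cases s) auto
    then have "w = p @ True # (s' @ True # y')" using 2 w by simp
    then show ?thesis using u unfolding left_of_def by blast
  qed
qed

lemma left_of_irrefl: "\<not> left_of u u"
  unfolding left_of_def by auto

lemma left_of_total: "u \<parallel> v \<Longrightarrow> left_of u v \<or> left_of v u"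
proof -
  assume "u \<parallel> v"
  from parallel_decomp[OF this] obtain p b x c y
    where "b \<noteq> c" "u = p @ b # x" "v = p @ c # y" by blast
  then show ?thesis unfolding left_of_def by (cases b; cases c) auto
qed

lemma finite_leaves: "finite_binary_tree T \<Longrightarrow> finite (leaves T)"
proof -
  assume "finite_binary_tree T"
  then have "finite T" unfolding finite_binary_tree_def by blast
  then have "finite (W -` T)" by (rule finite_vimageI) (simp add: inj_on_def)
  then show ?thesis by (rule rev_finite_subset) (auto simp: leaves_def)
qed

lemma leaf_prefix_eq:
  assumes "finite_binary_tree T" "u \<in> leaves T" "W v \<in> T" "prefix u v"
  shows "u = v"
proof (rule ccontr)
  assume "u \<noteq> v"
  obtain y where y: "v = u @ y" using assms(4) by (auto simp: prefix_def)
  with \<open>u \<noteq> v\<close> obtain b z where "y = b # z" by (cases y) auto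
  with y have v: "v = (u @ [b]) @ z" by simp
  then have "W (u @ [b]) \<in> T" using assms unfolding finite_binary_tree_def by blast
  then show False using assms(2) by (cases b) (auto simp: leaves_def)
qed

lemma leaves_total:
  assumes "finite_binary_tree T" "u \<in> leaves T" "v \<in> leaves T" "u \<noteq> v"
  shows "left_of u v \<or> left_of v u"
  using assms leaf_prefix_eq[of T u v] leaf_prefix_eq[of T v u]
  by (intro left_of_total) (auto simp: leaves_def)

lemma leaf_number_less:
  assumes "finite_binary_tree T" "u \<in> leaves T" "left_of u v"
  shows "leaf_number T u < leaf_number T v"
proof -
  have "{x \<in> leaves T. left_of x u} \<subset> {x \<in> leaves T. left_of x v}"
    using assms left_of_trans left_of_irrefl by blast
  then show ?thesis unfolding leaf_number_def
    using finite_leaves[OF assms(1)] by (simp add: psubset_card_mono)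
qed

lemma leaf_number_less_iff:
  assumes "finite_binary_tree T" "u \<in> leaves T" "v \<in> leaves T"
  shows "leaf_number T u < leaf_number T v \<longleftrightarrow> left_of u v"
  by (metis assms leaf_number_less leaves_total less_asym less_irrefl)

lemma bij_betw_leaf_number:
  assumes T: "finite_binary_tree T"
  shows "bij_betw (leaf_number T) (leaves T) {1..card (leaves T)}"
proof -
  have inj: "inj_on (leaf_number T) (leaves T)"
    by (intro inj_onI) (metis T leaf_number_less leaves_total less_irrefl)
  have "leaf_number T v \<in> {1..card (leaves T)}" if "v \<in> leaves T" for v
  proof -
    have "{x \<in> leaves T. left_of x v} \<subset> leaves T" using that left_of_irrefl by blast
    then have "card {x \<in> leaves T. left_of x v} < card (leaves T)"
      using finite_leaves[OF T] by (rule psubset_card_mono[rotated])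
    then show ?thesis by (simp add: leaf_number_def)
  qed
  then have "leaf_number T ` leaves T = {1..card (leaves T)}"
    by (intro card_subset_eq) (auto simp: card_image[OF inj])
  with inj show ?thesis by (simp add: bij_betw_def)
qed

lemma leaf_below_exists:
  assumes T: "finite_binary_tree T" and a: "W a \<in> T"
  shows "\<exists>u \<in> leaves T. prefix a u"
proof -
  let ?S = "{u. W u \<in> T \<and> prefix a u}"
  have "finite T" using T unfolding finite_binary_tree_def by blast
  then have "finite (W -` T)" by (rule finite_vimageI) (simp add: inj_on_def)
  then have fin: "finite ?S" by (rule rev_finite_subset) auto
  have "Max (length ` ?S) \<in> length ` ?S"
    using fin a by (intro Max_in) auto
  then obtain u where u: "u \<in> ?S" "length u = Max (length ` ?S)" by auto
  have "W (u @ [b]) \<notin> T" for b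
  proof
    assume "W (u @ [b]) \<in> T"
    then have "u @ [b] \<in> ?S" using u(1) by (auto simp: prefix_def)
    then have "length (u @ [b]) \<in> length ` ?S" by (rule imageI)
    then have "length (u @ [b]) \<le> Max (length ` ?S)"
      using fin by (intro Max_ge) simp_all
    with u(2) show False by simp
  qed
  then have "u \<in> leaves T" using u(1) by (simp add: leaves_def)
  then show ?thesis using u(1) by auto
qed

lemma leaves_below_convex:
  assumes T: "finite_binary_tree T"
    and x: "x \<in> leaves T" "prefix a x" and y: "y \<in> leaves T" "prefix a y"
    and v: "v \<in> leaves T" "left_of x v" "left_of v y"
  shows "prefix a v"
proof (rule ccontr)
  assume na: "\<not> prefix a v"
  have "\<not> prefix v a"
  proof
    assume "prefix v a"
    then have "prefix v x" using x(2) by (rule prefix_order.trans)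
    then have "v = x" using leaf_prefix_eq[OF T v(1)] x(1) by (simp add: leaves_def)
    then show False using v(2) left_of_irrefl by simp
  qed
  with na have "a \<parallel> v" by blast
  from parallel_decomp[OF this] obtain p b a' c v'
    where bc: "b \<noteq> c" and a: "a = p @ b # a'" and v': "v = p @ c # v'" by blast
  obtain x' y' where x': "x = a @ x'" and y': "y = a @ y'"
    using x(2) y(2) by (auto simp: prefix_def)
  show False
  proof (cases b)
    case True
    then have "left_of v x" using bc a v' x' unfolding left_of_def by fastforce
    then show False using v(2) left_of_trans left_of_irrefl by blast
  next
    case False
    then have "left_of y v" using bc a v' y' unfolding left_of_def by fastforce
    then show False using v(3) left_of_trans left_of_irrefl by blast
  qed
qed

lemma leaf_numbers_below_interval:
  assumes T: "finite_binary_tree T" and a: "W a \<in> T"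
  obtains i j where "1 \<le> i" "i \<le> j" "leaf_numbers_below T a = {i..j}"
    "dual_edge T a = {i - 1, j}"
proof -
  let ?N = "leaf_numbers_below T a"
  have sub: "?N \<subseteq> {1..card (leaves T)}"
    using bij_betw_leaf_number[OF T] unfolding leaf_numbers_below_def bij_betw_def by blast
  have fin: "finite ?N" using sub by (rule finite_subset) simp
  have ne: "?N \<noteq> {}"
    using leaf_below_exists[OF T a] unfolding leaf_numbers_below_def by blast
  obtain x where x: "x \<in> leaves T" "prefix a x" "Min ?N = leaf_number T x"
    using Min_in[OF fin ne] unfolding leaf_numbers_below_def by blast
  obtain y where y: "y \<in> leaves T" "prefix a y" "Max ?N = leaf_number T y"
    using Max_in[OF fin ne] unfolding leaf_numbers_below_def by blast
  have conv: "k \<in> ?N" if k: "Min ?N \<le> k" "k \<le> Max ?N" for k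
  proof -
    have "Min ?N \<in> {1..card (leaves T)}" "Max ?N \<in> {1..card (leaves T)}"
      using Min_in[OF fin ne] Max_in[OF fin ne] sub by blast+
    then have "k \<in> {1..card (leaves T)}" using k by simp
    then have "k \<in> leaf_number T ` leaves T"
      using bij_betw_leaf_number[OF T] by (simp add: bij_betw_def)
    then obtain v where v: "v \<in> leaves T" "k = leaf_number T v" by blast
    have "prefix a v"
    proof (cases "v = x \<or> v = y")
      case True
      then show ?thesis using x y by blast
    next
      case False
      have inj: "leaf_number T v \<noteq> leaf_number T z" if "z \<in> leaves T" "v \<noteq> z" for z
        using bij_betw_leaf_number[OF T] v(1) that by (auto simp: bij_betw_def inj_on_def)
      have "leaf_number T x < leaf_number T v" "leaf_number T v < leaf_number T y"
        using False inj[of x] inj[of y] x y k v by auto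
      then have "left_of x v" "left_of v y"
        using leaf_number_less_iff[OF T] x(1) y(1) v(1) by auto
      then show ?thesis using leaves_below_convex[OF T x(1,2) y(1,2) v(1)] by blast
    qed
    then show ?thesis using v unfolding leaf_numbers_below_def by blast
  qed
  have "?N = {Min ?N..Max ?N}"
  proof
    show "?N \<subseteq> {Min ?N..Max ?N}" using Min_le[OF fin] Max_ge[OF fin]
      by (meson atLeastAtMost_iff subsetI)
    show "{Min ?N..Max ?N} \<subseteq> ?N" using conv by (meson atLeastAtMost_iff subsetI)
  qed
  moreover have "1 \<le> Min ?N"
    using Min_in[OF fin ne] sub by (meson atLeastAtMost_iff subsetD)
  moreover have "Min ?N \<le> Max ?N" using Min_le[OF fin] Max_in[OF fin ne] by blast
  ultimately show ?thesis using that unfolding dual_edge_def by blast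
qed

lemma dual_edge_eq_iff:
  assumes "finite_binary_tree D" "finite_binary_tree R" "W a \<in> D" "W b \<in> R"
  shows "dual_edge D a = dual_edge R b \<longleftrightarrow> leaf_numbers_below D a = leaf_numbers_below R b"
proof -
  obtain i j where ij: "1 \<le> i" "i \<le> j" "leaf_numbers_below D a = {i..j}"
    "dual_edge D a = {i - 1, j}"
    using leaf_numbers_below_interval[OF assms(1,3)] .
  obtain k l where kl: "1 \<le> k" "k \<le> l" "leaf_numbers_below R b = {k..l}"
    "dual_edge R b = {k - 1, l}"
    using leaf_numbers_below_interval[OF assms(2,4)] .
  show ?thesis using ij kl by (auto simp: doubleton_eq_iff)
qed

lemma prime_pair_iff_leaf_numbers:
  "prime_pair D R \<longleftrightarrow>
     finite_binary_tree D \<and> finite_binary_tree R \<and>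
     card (leaves D) = card (leaves R) \<and> card (leaves D) \<ge> 2 \<and>
     \<not> (\<exists>a \<in> internal D - {[]}. \<exists>b \<in> internal R - {[]}.
          leaf_numbers_below D a = leaf_numbers_below R b)"
proof -
  have "diagonals D \<inter> diagonals R = {} \<longleftrightarrow>
      \<not> (\<exists>a \<in> internal D - {[]}. \<exists>b \<in> internal R - {[]}.
          leaf_numbers_below D a = leaf_numbers_below R b)"
    if "finite_binary_tree D" "finite_binary_tree R"
  proof -
    have "dual_edge D a = dual_edge R b \<longleftrightarrow> leaf_numbers_below D a = leaf_numbers_below R b"
      if "a \<in> internal D" "b \<in> internal R" for a b
      using that dual_edge_eq_iff[OF \<open>finite_binary_tree D\<close> \<open>finite_binary_tree R\<close>]
      by (simp add: internal_def)
    then show ?thesis unfolding diagonals_def by blast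
  qed
  then show ?thesis unfolding prime_pair_def by blast
qed


section \<open>Colorings\<close>

type_synonym color = "bit \<times> bit"

definition color1 :: color where "color1 = (0, 1)"
definition color2 :: color where "color2 = (1, 0)"
definition color3 :: color where "color3 = (1, 1)"

text \<open>An edge of a tree is represented by the word at its lower end.\<close>

definition tree_edges :: "vertex set \<Rightarrow> word set" where
  "tree_edges T = {u. W u \<in> T}"

definition parent :: "word \<Rightarrow> vertex" where
  "parent u = (if u = [] then Star else W (butlast u))"

definition edge_ends :: "word \<Rightarrow> vertex set" where
  "edge_ends u = {parent u, W u}"

text \<open>
  Colorings are extensional functions on the edges, so that equality of colorings is
  agreement on all edges of the tree.
\<close>

definition coloring :: "vertex set \<Rightarrow> (word \<Rightarrow> color) \<Rightarrow> bool" where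
  "coloring T c \<longleftrightarrow>
     c \<in> tree_edges T \<rightarrow>\<^sub>E {color1, color2, color3} \<and>
     (\<forall>e \<in> tree_edges T. \<forall>f \<in> tree_edges T.
        e \<noteq> f \<and> edge_ends e \<inter> edge_ends f \<noteq> {} \<longrightarrow> c e \<noteq> c f)"

definition sign_positive :: "(word \<Rightarrow> color) \<Rightarrow> word \<Rightarrow> bool" where
  "sign_positive c u \<longleftrightarrow>
     (c u, c (u @ [False]), c (u @ [True])) \<in>
       {(color1, color2, color3), (color2, color3, color1), (color3, color1, color2)}"

definition normal :: "(word \<Rightarrow> color) \<Rightarrow> bool" where
  "normal c \<longleftrightarrow> c [] = color1"

definition compatible :: "vertex set \<Rightarrow> (word \<Rightarrow> color) \<Rightarrow> signed_edge list \<Rightarrow> bool" where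
  "compatible T c G \<longleftrightarrow>
     (\<forall>e \<in> set G. positive e \<longleftrightarrow>
        (\<exists>u \<in> internal T. \<exists>v \<in> internal T.
           ends e = {W u, W v} \<and> (sign_positive c u \<longleftrightarrow> sign_positive c v)))"

end

theory Submission
  imports Defs
begin

text \<open>
  A normal coloring is determined by its derived signs, and every assignment of signs to
  the internal vertices comes from a normal coloring: the color of an edge and the sign of the
  vertex below it give the colors of the two child edges (\<open>coloring_unique\<close>,
  \<open>color_of_signs\<close>). The theorem is thus about sign assignments that are equal across
  the positive edges of the signed graph, different across the negative ones, and positive at
  \<open>[]\<close>. If the signed graph is balanced and connects all internal vertices of
  \<open>T\<close>, there is exactly one: the sign of a vertex is the parity of the number of
  negative edges on any walk from \<open>[]\<close> to it.

  So primality has to imply connectedness. Think of the internal vertices as the triangles of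
  the dual triangulation. A rotation flips one diagonal, and the edge that it adds to the signed
  graph joins the two triangles beside that diagonal, traced back to \<open>T\<close>. Suppose that
  the triangles of \<open>T\<close> fall into two classes that no edge of the graph joins. Then some
  diagonal of \<open>T\<close> has triangles of different classes on its two sides. It is never
  flipped, because the diagonals that are flipped have the same class on both sides. It also
  keeps its two classes: a flip replaces two triangles of one class by two triangles which
  inherit that class. Hence the diagonal is still there at the end of the path, and
  the pair is not prime. The step for one rotation is \<open>separated_rotate_tree\<close>, with the
  diagonal recorded by the leaf numbers that it cuts off; \<open>class_constant\<close> draws the
  conclusion.

  That conclusion is phrased for a class function \<open>C\<close> that is constant along edges, which
  serves existence and uniqueness alike: for existence \<open>C\<close> is reachability from \<open>[]\<close>, for
  uniqueness it is the agreement of the signs of two colorings.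
\<close>

section \<open>Signs determine colorings\<close>

definition next_color :: "color \<Rightarrow> color" where
  "next_color x = (if x = color1 then color2 else if x = color2 then color3 else color1)"

text \<open>
  At a positive vertex the cyclic order of the colors runs through parent, left child, right
  child; at a negative vertex the two children are exchanged.
\<close>

definition child_color :: "color \<Rightarrow> bool \<Rightarrow> bool \<Rightarrow> color" where
  "child_color x s b = (if s = b then next_color (next_color x) else next_color x)"

lemma color_distinct [simp]:
  "color1 \<noteq> color2" "color2 \<noteq> color1" "color1 \<noteq> color3" "color3 \<noteq> color1"
  "color2 \<noteq> color3" "color3 \<noteq> color2"
  by (simp_all add: color1_def color2_def color3_def)

lemma child_color_in: "child_color x s b \<in> {color1, color2, color3}"
  by (simp add: child_color_def next_color_def)

lemma child_color_neq:
  assumes "x \<in> {color1, color2, color3}"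
  shows "child_color x s b \<noteq> x" "child_color x s True \<noteq> child_color x s False"
  using assms by (auto simp: child_color_def next_color_def)

lemma tree_children:
  assumes "finite_binary_tree T"
  shows "u \<in> internal T \<longleftrightarrow> W (u @ [b]) \<in> T"
  using assms unfolding finite_binary_tree_def internal_def leaves_def by (cases b) auto

text \<open>
  An edge is named by its lower end, and only the edge from \<open>Star\<close> has no parent word. So two
  edges meet just in the two ways in which edges meet at an internal vertex: as parent and
  child, or as siblings.
\<close>

lemma edges_meet_iff:
  "e \<noteq> f \<Longrightarrow> edge_ends e \<inter> edge_ends f \<noteq> {} \<longleftrightarrow>
     (\<exists>b. e = f @ [b]) \<or> (\<exists>b. f = e @ [b]) \<or> (\<exists>u b c. e = u @ [b] \<and> f = u @ [c] \<and> b \<noteq> c)"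
  by (cases e rule: rev_cases; cases f rule: rev_cases) (auto simp: edge_ends_def parent_def)

text \<open>
  Three distinct colors at a vertex leave two possibilities for its child edges once the color
  above is known, and the sign says which of them occurs.
\<close>

lemma child_color_of_coloring:
  assumes T: "finite_binary_tree T" and c: "coloring T c" and u: "u \<in> internal T"
  shows "c (u @ [b]) = child_color (c u) (sign_positive c u) b"
proof -
  have e: "u \<in> tree_edges T" "u @ [False] \<in> tree_edges T" "u @ [True] \<in> tree_edges T"
    using u tree_children[OF T] by (auto simp: tree_edges_def internal_def)
  have "c x \<in> {color1, color2, color3}" if "x \<in> tree_edges T" for x
    using c that unfolding coloring_def by blast
  then have cols: "c u \<in> {color1, color2, color3}" "c (u @ [False]) \<in> {color1, color2, color3}"
    "c (u @ [True]) \<in> {color1, color2, color3}" using e by blast+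
  have ne: "c x \<noteq> c y"
    if "x \<in> tree_edges T" "y \<in> tree_edges T" "x \<noteq> y" "edge_ends x \<inter> edge_ends y \<noteq> {}" for x y
    using c that unfolding coloring_def by blast
  have "c u \<noteq> c (u @ [False])" "c u \<noteq> c (u @ [True])" "c (u @ [False]) \<noteq> c (u @ [True])"
    by (rule ne; use e in \<open>simp add: edges_meet_iff ex_bool_eq\<close>)+
  then show ?thesis using cols
    by (cases b) (auto simp: child_color_def next_color_def sign_positive_def)
qed

lemma coloring_unique:
  assumes T: "finite_binary_tree T"
    and c: "coloring T c" "normal c" and c': "coloring T c'" "normal c'"
    and s: "\<And>u. u \<in> internal T \<Longrightarrow> sign_positive c u = sign_positive c' u"
  shows "c = c'"
proof
  fix v
  show "c v = c' v"
  proof (cases "v \<in> tree_edges T")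
    case False
    then show ?thesis using c(1) c'(1) unfolding coloring_def
      by (metis PiE_arb)
  next
    case True
    then show ?thesis
    proof (induction v rule: rev_induct)
      case Nil
      then show ?case using c(2) c'(2) by (simp add: normal_def)
    next
      case (snoc b u)
      then have u: "u \<in> internal T" using tree_children[OF T] by (simp add: tree_edges_def)
      then have "u \<in> tree_edges T" by (simp add: tree_edges_def internal_def)
      with snoc.IH show ?case
        using s[OF u] child_color_of_coloring[OF T c(1) u] child_color_of_coloring[OF T c'(1) u]
        by simp
    qed
  qed
qed

text \<open>
  The argument lists the letters of a word from its last one, so that the recursion
  walks from a vertex up to the root.
\<close>

fun color_upwards :: "(word \<Rightarrow> bool) \<Rightarrow> word \<Rightarrow> color" where
  "color_upwards s [] = color1"
| "color_upwards s (b # x) = child_color (color_upwards s x) (s (rev x)) b"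

definition color_of_signs :: "vertex set \<Rightarrow> (word \<Rightarrow> bool) \<Rightarrow> word \<Rightarrow> color" where
  "color_of_signs T s = restrict (\<lambda>v. color_upwards s (rev v)) (tree_edges T)"

lemma color_upwards_in: "color_upwards s x \<in> {color1, color2, color3}"
proof (cases x)
  case Nil
  then show ?thesis by simp
next
  case (Cons b y)
  then show ?thesis using child_color_in by simp
qed

lemma color_of_signs:
  assumes T: "finite_binary_tree T"
  shows "coloring T (color_of_signs T s)" "normal (color_of_signs T s)"
    and "u \<in> internal T \<Longrightarrow> sign_positive (color_of_signs T s) u = s u"
proof -
  have "[] \<in> tree_edges T" using T by (simp add: finite_binary_tree_def tree_edges_def)
  then show "normal (color_of_signs T s)" by (simp add: normal_def color_of_signs_def)
  have "color_upwards s (rev e) \<noteq> color_upwards s (rev f)"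
    if ef: "e \<noteq> f" "edge_ends e \<inter> edge_ends f \<noteq> {}" for e f
  proof -
    consider b where "e = f @ [b]" | b where "f = e @ [b]"
      | x b b' where "e = x @ [b]" "f = x @ [b']" "b \<noteq> b'"
      using edges_meet_iff[OF ef(1)] ef(2) by blast
    then show ?thesis
    proof cases
      case 1
      then show ?thesis using child_color_neq(1)[OF color_upwards_in] by simp
    next
      case 2
      then show ?thesis using child_color_neq(1)[OF color_upwards_in, THEN not_sym] by simp
    next
      case 3
      then show ?thesis
        using child_color_neq(2)[OF color_upwards_in]
          child_color_neq(2)[OF color_upwards_in, THEN not_sym] by (cases b; cases b') simp_all
    qed
  qed
  then show "coloring T (color_of_signs T s)"
    unfolding coloring_def color_of_signs_def using color_upwards_in by auto
next
  assume u: "u \<in> internal T"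
  have "u \<in> tree_edges T" "u @ [False] \<in> tree_edges T" "u @ [True] \<in> tree_edges T"
    using u tree_children[OF T] by (auto simp: tree_edges_def internal_def)
  then show "sign_positive (color_of_signs T s) u = s u"
    using color_upwards_in[of s "rev u"]
    by (auto simp: sign_positive_def color_of_signs_def child_color_def next_color_def)
qed


section \<open>Rotations and the leaves\<close>

definition rotate_word :: "word \<Rightarrow> word \<Rightarrow> word" where
  "rotate_word u v = (if prefix u v then u @ rotate_suffix (drop (length u) v) else v)"

lemma rotation_at_W: "rotation_at u (W v) = W (rotate_word u v)"
  by (simp add: rotate_word_def)

lemma rotate_word_simps [simp]:
  "rotate_word u u = u @ [True]"
  "rotate_word u (u @ [False]) = u"
  "rotate_word u (u @ False # False # x) = u @ False # x"
  "rotate_word u (u @ False # True # x) = u @ True # False # x"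
  "rotate_word u (u @ True # x) = u @ True # True # x"
  "\<not> prefix u v \<Longrightarrow> rotate_word u v = v"
  by (simp_all add: rotate_word_def)

lemma word_position:
  obtains "\<not> prefix u v" | "v = u" | "v = u @ [False]" | x where "v = u @ False # False # x"
    | x where "v = u @ False # True # x" | x where "v = u @ True # x"
proof (cases "prefix u v")
  case True
  then obtain y where "v = u @ y" by (auto simp: prefix_def)
  then show ?thesis using that by (cases y rule: rotate_suffix.cases) auto
qed (rule that)

lemma rotated_word_position:
  obtains "\<not> prefix u v" | "v = u" | "v = u @ [True]" | x where "v = u @ False # x"
    | x where "v = u @ True # False # x" | x where "v = u @ True # True # x"
proof (cases "prefix u v")
  case True
  then obtain y where y: "v = u @ y" by (auto simp: prefix_def)
  have "y = [] \<or> y = [True] \<or> (\<exists>x. y = False # x) \<or> (\<exists>x. y = True # False # x)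
      \<or> (\<exists>x. y = True # True # x)"
    by (metis (full_types) neq_Nil_conv)
  then show ?thesis using y that by auto
qed (rule that)

lemma rotate_word_surj: "\<exists>x. rotate_word u x = v"
  by (cases u v rule: rotated_word_position) (metis rotate_word_simps)+

lemma rotate_word_image:
  assumes "\<And>v. rotate_word u v \<in> B \<longleftrightarrow> v \<in> A"
  shows "B = rotate_word u ` A"
  using assms rotate_word_surj[of u]
  by (metis (no_types, lifting) imageE image_eqI subsetI subset_antisym)

lemma rotate_word_eq_iff: "rotate_word u x = rotate_word u y \<longleftrightarrow> x = y"
  using bij_rotation_at[of u] by (metis bij_pointE rotation_at_W vertex.inject)

text \<open>
  A rotation moves a vertex together with its children, except at the two pivots and at the
  parent of the upper pivot.
\<close>

lemma rotate_word_snoc: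
  assumes "v \<noteq> u" "v \<noteq> u @ [False]" "v @ [b] \<noteq> u"
  shows "rotate_word u (v @ [b]) = rotate_word u v @ [b]"
  using assms by (cases u v rule: word_position) auto

lemma left_of_append: "left_of (u @ x) (u @ y) \<longleftrightarrow> left_of x y"
proof
  assume "left_of (u @ x) (u @ y)"
  then show "left_of x y"
    unfolding left_of_def
    by (induction u) (auto simp: Cons_eq_append_conv)
next
  assume "left_of x y"
  then show "left_of (u @ x) (u @ y)" unfolding left_of_def by (metis append.assoc)
qed

lemma left_of_Cons:
  "left_of (b # x) (c # y) \<longleftrightarrow> (\<not> b \<and> c) \<or> (b = c \<and> left_of x y)"
  unfolding left_of_def by (cases b; cases c) (auto simp: Cons_eq_append_conv)

lemma left_of_Nil [simp]: "\<not> left_of [] y" "\<not> left_of x []"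
  by (simp_all add: left_of_def)

lemma left_of_rotate_suffix:
  assumes "x \<notin> {[], [False]}" "y \<notin> {[], [False]}" "left_of x y"
  shows "left_of (rotate_suffix x) (rotate_suffix y)"
  using assms
  by (cases x rule: rotate_suffix.cases; cases y rule: rotate_suffix.cases)
    (auto simp: left_of_Cons)

lemma left_of_outside:
  assumes "\<not> prefix u v"
  shows "left_of v (u @ x) \<longleftrightarrow> left_of v u" "left_of (u @ x) v \<longleftrightarrow> left_of u v"
proof -
  have 1: "left_of v (u @ x) = left_of v u \<and> left_of (u @ x) v = left_of u v"
    using assms
  proof (induction u arbitrary: v)
    case Nil
    then show ?case by simp
  next
    case (Cons b u)
    then show ?case by (cases v) (auto simp: left_of_Cons)
  qed
  then show "left_of v (u @ x) \<longleftrightarrow> left_of v u" "left_of (u @ x) v \<longleftrightarrow> left_of u v" by auto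
qed

text \<open>
  A rotation respects the left-to-right order except at the lower pivot, which moves up to
  become an ancestor of words that were to its right. Leaves of a tree to which the rotation
  applies are never pivots.
\<close>

lemma left_of_rotate_word:
  assumes "x \<notin> {u, u @ [False]}" "y \<notin> {u, u @ [False]}" "left_of x y"
  shows "left_of (rotate_word u x) (rotate_word u y)"
proof (cases "prefix u x"; cases "prefix u y")
  assume "prefix u x" "prefix u y"
  then obtain x' y' where "x = u @ x'" "y = u @ y'" by (auto simp: prefix_def)
  then show ?thesis using assms left_of_rotate_suffix[of x' y']
    by (simp add: rotate_word_def left_of_append)
qed (use assms(3) left_of_outside in \<open>auto simp: rotate_word_def prefix_def\<close>)

text \<open>
  The two directions of one rotation yield the same relation between two trees: a rotation by
  \<open>Fwd u\<close> leads from \<open>S\<close> to \<open>S'\<close>, one by \<open>Bwd u\<close> from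
  \<open>S'\<close> to \<open>S\<close>. Everything below is proved for the relation, hence once for
  both directions.
\<close>

definition rotated :: "word \<Rightarrow> vertex set \<Rightarrow> vertex set \<Rightarrow> bool" where
  "rotated u S S' \<longleftrightarrow> finite_binary_tree S \<and> finite_binary_tree S' \<and>
     u \<in> internal S \<and> u @ [False] \<in> internal S \<and>
     u \<in> internal S' \<and> u @ [True] \<in> internal S' \<and> S' = rotation_at u ` S"

text \<open>
  Closure under prefixes and siblings as one local condition on each vertex and its children,
  the form that can be checked position by position after a rotation.
\<close>

lemma finite_binary_tree_iff:
  "finite_binary_tree T \<longleftrightarrow> finite T \<and> Star \<in> T \<and> W [] \<in> T \<and>
     (\<forall>u b. W (u @ [b]) \<in> T \<longrightarrow> W u \<in> T \<and> W (u @ [\<not> b]) \<in> T)"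
proof -
  have "W u \<in> T" if "\<forall>u b. W (u @ [b]) \<in> T \<longrightarrow> W u \<in> T" "W (u @ v) \<in> T" for u v
    using that(2) by (induction v rule: rev_induct) (use that(1) in \<open>auto simp flip: append_assoc\<close>)
  then show ?thesis unfolding finite_binary_tree_def by (metis (full_types))
qed

lemma tree_prefix:
  "finite_binary_tree T \<Longrightarrow> W (u @ v) \<in> T \<Longrightarrow> W u \<in> T"
  unfolding finite_binary_tree_def by blast

lemma mem_rotation_image: "W (rotate_word u v) \<in> rotation_at u ` S \<longleftrightarrow> W v \<in> S"
  by (metis (no_types, lifting) bij_rotation_at bij_is_inj inj_image_mem_iff rotation_at_W)

lemma Star_rotation_image: "Star \<in> rotation_at u ` S \<longleftrightarrow> Star \<in> S"
  by (metis bij_rotation_at bij_is_inj inj_image_mem_iff rotation_at.simps(1))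

lemma rotated_mem:
  assumes "S' = rotation_at u ` S"
  shows "\<not> prefix u v \<Longrightarrow> W v \<in> S' \<longleftrightarrow> W v \<in> S"
    "W u \<in> S' \<longleftrightarrow> W (u @ [False]) \<in> S"
    "W (u @ [True]) \<in> S' \<longleftrightarrow> W u \<in> S"
    "W (u @ False # x) \<in> S' \<longleftrightarrow> W (u @ False # False # x) \<in> S"
    "W (u @ True # False # x) \<in> S' \<longleftrightarrow> W (u @ False # True # x) \<in> S"
    "W (u @ True # True # x) \<in> S' \<longleftrightarrow> W (u @ True # x) \<in> S"
  unfolding assms by (metis mem_rotation_image rotate_word_simps)+

text \<open>
  Away from the pivots the vertices and their children correspond one to one. At the pivots the
  needed vertices are present because both pivots are internal.
\<close>

lemma rotated_forward:
  assumes S: "finite_binary_tree S" and u: "u \<in> internal S" "u @ [False] \<in> internal S"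
  shows "rotated u S (rotation_at u ` S)"
proof -
  define S' where "S' = rotation_at u ` S"
  note mem = rotated_mem[OF S'_def]
  have in0: "W u \<in> S" "W (u @ [b]) \<in> S" "W (u @ False # [b]) \<in> S" for b
    using u tree_children[OF S, of u b] tree_children[OF S, of "u @ [False]" b]
    by (auto simp: internal_def)
  have step: "W v \<in> S \<and> W (v @ [\<not> b]) \<in> S" if "W (v @ [b]) \<in> S" for v b
    using S that unfolding finite_binary_tree_iff by blast
  have "W v \<in> S' \<and> W (v @ [\<not> b]) \<in> S'" if v: "W (v @ [b]) \<in> S'" for v b
  proof (cases u v rule: rotated_word_position)
    case 1
    have out: "W (v @ [c]) \<in> S' \<longleftrightarrow> W (v @ [c]) \<in> S" for c
    proof (cases "v @ [c] = u")
      case True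
      then show ?thesis using mem(2) in0 by simp
    next
      case False
      then show ?thesis using 1 by (intro mem(1)) simp
    qed
    then show ?thesis using v step[of v b] mem(1)[OF 1] by simp
  next
    case 2
    then show ?thesis using in0 mem(2) mem(3) mem(4)[of "[]"] by (cases b) auto
  next
    case 3
    then show ?thesis using in0 mem(3) mem(5)[of "[]"] mem(6)[of "[]"] by (cases b) auto
  next
    case (4 x)
    then show ?thesis using v mem(4) step[of "u @ False # False # x" b] by simp
  next
    case (5 x)
    then show ?thesis using v mem(5) step[of "u @ False # True # x" b] by simp
  next
    case (6 x)
    then show ?thesis using v mem(6) step[of "u @ True # x" b] by simp
  qed
  moreover have "finite S'" "Star \<in> S'"
    using S Star_rotation_image unfolding S'_def finite_binary_tree_def by auto
  moreover have "W [] \<in> S'"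
  proof (cases "u = []")
    case True
    then show ?thesis using mem(2) in0(2) by simp
  next
    case False
    then show ?thesis using mem(1)[of "[]"] S by (simp add: finite_binary_tree_def)
  qed
  ultimately have S': "finite_binary_tree S'" unfolding finite_binary_tree_iff by blast
  then show ?thesis
    using S u in0 tree_children[OF S', of u True] tree_children[OF S', of "u @ [True]" True]
      mem(3) mem(6)[of "[]"]
    unfolding rotated_def S'_def[symmetric] by simp
qed

lemma rotated_backward:
  assumes S': "finite_binary_tree S'" and u: "u \<in> internal S'" "u @ [True] \<in> internal S'"
  shows "rotated u (inv (rotation_at u) ` S') S'"
proof -
  define S where "S = inv (rotation_at u) ` S'"
  have S'_eq: "S' = rotation_at u ` S"
    unfolding S_def by (simp add: bij_rotation_at bij_is_surj image_f_inv_f)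
  note mem = rotated_mem[OF S'_eq, symmetric]
  have in0: "W u \<in> S'" "W (u @ [b]) \<in> S'" "W (u @ True # [b]) \<in> S'" for b
    using u tree_children[OF S', of u b] tree_children[OF S', of "u @ [True]" b]
    by (auto simp: internal_def)
  have step: "W v \<in> S' \<and> W (v @ [\<not> b]) \<in> S'" if "W (v @ [b]) \<in> S'" for v b
    using S' that unfolding finite_binary_tree_iff by blast
  have "W v \<in> S \<and> W (v @ [\<not> b]) \<in> S" if v: "W (v @ [b]) \<in> S" for v b
  proof (cases u v rule: word_position)
    case 1
    have out: "W (v @ [c]) \<in> S \<longleftrightarrow> W (v @ [c]) \<in> S'" for c
    proof (cases "v @ [c] = u")
      case True
      then show ?thesis using mem(3) in0 by simp
    next
      case False
      then show ?thesis using 1 by (intro mem(1)) simp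
    qed
    then show ?thesis using v step[of v b] mem(1)[OF 1] by simp
  next
    case 2
    then show ?thesis using in0 mem(2) mem(3) mem(6)[of "[]"] by (cases b) auto
  next
    case 3
    then show ?thesis using in0 mem(2) mem(4)[of "[]"] mem(5)[of "[]"] by (cases b) auto
  next
    case (4 x)
    then show ?thesis using v mem(4) step[of "u @ False # x" b] by simp
  next
    case (5 x)
    then show ?thesis using v mem(5) step[of "u @ True # False # x" b] by simp
  next
    case (6 x)
    then show ?thesis using v mem(6) step[of "u @ True # True # x" b] by simp
  qed
  moreover have "finite S" "Star \<in> S"
    using S' Star_rotation_image[of u S] unfolding S'_eq[symmetric]
    by (auto simp: S_def finite_binary_tree_def)
  moreover have "W [] \<in> S"
  proof (cases "u = []")
    case True
    then show ?thesis using mem(3) in0(2) by simp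
  next
    case False
    then show ?thesis using mem(1)[of "[]"] S' by (simp add: finite_binary_tree_def)
  qed
  ultimately have S: "finite_binary_tree S" unfolding finite_binary_tree_iff by blast
  then show ?thesis
    using S' u in0 S'_eq tree_children[OF S, of u False] tree_children[OF S, of "u @ [False]" False]
      mem(2) mem(4)[of "[]"]
    unfolding rotated_def S_def[symmetric] by simp
qed

context
  fixes u S S'
  assumes rotated: "rotated u S S'"
begin

lemma rotated_trees: "finite_binary_tree S" "finite_binary_tree S'"
  using rotated unfolding rotated_def by auto

lemma rotated_pivots:
  "u \<in> internal S" "u @ [False] \<in> internal S" "u \<in> internal S'" "u @ [True] \<in> internal S'"
  using rotated unfolding rotated_def by auto

lemma rotated_word_mem: "W (rotate_word u v) \<in> S' \<longleftrightarrow> W v \<in> S"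
  using rotated mem_rotation_image unfolding rotated_def by blast

lemma rotated_internal: "rotate_word u v \<in> internal S' \<longleftrightarrow> v \<in> internal S"
proof -
  note child = tree_children[OF rotated_trees(1)] tree_children[OF rotated_trees(2)]
  consider "v = u" | "v = u @ [False]" | b where "v @ [b] = u"
    | "v \<noteq> u" "v \<noteq> u @ [False]" "\<And>b. v @ [b] \<noteq> u" by blast
  then show ?thesis
  proof cases
    case 1
    then show ?thesis using rotated_pivots by simp
  next
    case 2
    then show ?thesis using rotated_pivots by simp
  next
    case 3
    have "W u \<in> S" "W u \<in> S'" using rotated_pivots by (auto simp: internal_def)
    moreover have "rotate_word u v = v" using 3 by (intro rotate_word_simps(6)) auto
    ultimately show ?thesis using 3 child by metis
  next
    case 4
    then show ?thesis using child rotate_word_snoc rotated_word_mem by metis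
  qed
qed

lemma rotated_leaves: "rotate_word u v \<in> leaves S' \<longleftrightarrow> v \<in> leaves S"
  using rotated_internal[of v] rotated_word_mem[of v] by (auto simp: internal_def leaves_def)

lemma rotated_leaves_image: "leaves S' = rotate_word u ` leaves S"
  using rotated_leaves by (rule rotate_word_image)

lemma leaf_not_pivot: "v \<in> leaves S \<Longrightarrow> v \<notin> {u, u @ [False]}"
  using rotated_pivots by (auto simp: internal_def)

lemma rotated_left_of:
  assumes "x \<in> leaves S" "y \<in> leaves S"
  shows "left_of (rotate_word u x) (rotate_word u y) \<longleftrightarrow> left_of x y"
proof -
  have mono: "left_of (rotate_word u x) (rotate_word u y)"
    if "left_of x y" "x \<in> leaves S" "y \<in> leaves S" for x y
    using that leaf_not_pivot left_of_rotate_word by blast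
  have "\<not> (left_of a b \<and> left_of b a)" for a b using left_of_trans left_of_irrefl by blast
  then show ?thesis
    using mono[of x y] mono[of y x] assms leaves_total[OF rotated_trees(1) assms] left_of_irrefl
    by metis
qed

text \<open>
  The leaves of both trees correspond in an order preserving way, so they carry the same numbers.
\<close>

lemma rotated_leaf_number:
  assumes "v \<in> leaves S"
  shows "leaf_number S' (rotate_word u v) = leaf_number S v"
proof -
  have "{x \<in> leaves S'. left_of x (rotate_word u v)} = rotate_word u ` {x \<in> leaves S. left_of x v}"
    using rotated_left_of[OF _ assms] unfolding rotated_leaves_image by blast
  then show ?thesis unfolding leaf_number_def
    by (simp add: card_image inj_on_def rotate_word_eq_iff)
qed

end

section \<open>Separating diagonals survive rotations\<close>

text \<open>
  The edge of \<open>S\<close> above \<open>a\<close> and the edge of \<open>S'\<close> above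
  \<open>rotate_edge u a\<close> are dual to the same diagonal, unless \<open>a\<close> is the lower pivot
  \<open>u @ [False]\<close>, whose diagonal is flipped. Usually the lower end of an edge moves with
  the rotation. The exception is the edge above \<open>u\<close>, which stays in place while the
  vertex at its lower end changes.
\<close>

definition rotate_edge :: "word \<Rightarrow> word \<Rightarrow> word" where
  "rotate_edge u a = (if a = u then u else rotate_word u a)"

lemma prefix_outside: "\<not> prefix u a \<Longrightarrow> prefix a (u @ x) \<longleftrightarrow> prefix a u"
  using prefix_same_cases[of a "u @ x" u] by auto

lemma prefix_rotate_edge:
  assumes "a \<noteq> u @ [False]" "v \<notin> {u, u @ [False]}"
  shows "prefix (rotate_edge u a) (rotate_word u v) \<longleftrightarrow> prefix a v"
proof -
  have below: "prefix u (rotate_word u v) \<longleftrightarrow> prefix u v" for v by (simp add: rotate_word_def)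
  show ?thesis
  proof (cases "prefix u a")
    case False
    then have "a \<noteq> u" "\<not> prefix u a" by auto
    show ?thesis
    proof (cases "prefix u v")
      case True
      then obtain x y where "v = u @ x" "rotate_word u v = u @ y"
        using below unfolding prefix_def by blast
      then show ?thesis using \<open>a \<noteq> u\<close> \<open>\<not> prefix u a\<close> by (simp add: rotate_edge_def prefix_outside)
    next
      case False
      then show ?thesis using \<open>\<not> prefix u a\<close> \<open>a \<noteq> u\<close> by (simp add: rotate_edge_def)
    qed
  next
    case True
    show ?thesis
    proof (cases "a = u")
      case True
      then show ?thesis using below by (simp add: rotate_edge_def)
    next
      case False
      then have p: "prefix u (rotate_edge u a)" using True below by (simp add: rotate_edge_def)
      show ?thesis
      proof (cases "prefix u v")
        case False
        then show ?thesis using True p below by (meson prefix_order.trans)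
      next
        case True
        then show ?thesis using assms \<open>a \<noteq> u\<close> \<open>prefix u a\<close>
          by (cases u a rule: word_position; cases u v rule: word_position)
            (auto simp: rotate_edge_def)
      qed
    qed
  qed
qed

lemma rotated_leaf_numbers_below:
  assumes r: "rotated u S S'" and a: "a \<noteq> u @ [False]"
  shows "leaf_numbers_below S' (rotate_edge u a) = leaf_numbers_below S a"
proof -
  have "{v \<in> leaves S'. prefix (rotate_edge u a) v} = rotate_word u ` {v \<in> leaves S. prefix a v}"
    using leaf_not_pivot[OF r] prefix_rotate_edge[OF a] unfolding rotated_leaves_image[OF r] by blast
  then show ?thesis
    using rotated_leaf_number[OF r] unfolding leaf_numbers_below_def by (auto simp: image_iff)
qed

lemma rotate_edge_surj:
  assumes "a' \<noteq> u @ [True]" "a' \<noteq> []"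
  obtains a where "a \<noteq> u @ [False]" "a \<noteq> []" "a' = rotate_edge u a"
proof (cases "a' = u")
  case True
  then show ?thesis using that[of u] assms by (simp add: rotate_edge_def)
next
  case False
  obtain a where a: "rotate_word u a = a'" using rotate_word_surj by blast
  have "a \<noteq> u" "a \<noteq> u @ [False]" using a False assms by auto
  moreover have "a \<noteq> []"
  proof
    assume "a = []"
    then have "rotate_word u a = a" using \<open>a \<noteq> u\<close> by simp
    then show False using a \<open>a = []\<close> assms by simp
  qed
  ultimately show ?thesis using that a by (simp add: rotate_edge_def)
qed

text \<open>
  Edges other than the flipped one keep the classes of their two ends. Where an end is exchanged,
  one pivot takes the place of the other, and the pivots have the same class.
\<close>

lemma rotate_edge_classes:
  assumes C: "\<And>v. C' (rotate_word u v) = C v" and pivots: "C u = C (u @ [False])"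
    and a: "a \<noteq> []" "a \<noteq> u @ [False]"
  shows "C' (rotate_edge u a) = C a" "C' (butlast (rotate_edge u a)) = C (butlast a)"
    "rotate_edge u a \<noteq> []"
proof -
  have Cu: "C' u = C u" "C' (u @ [True]) = C u"
    using C[of u] C[of "u @ [False]"] pivots by simp_all
  show "C' (rotate_edge u a) = C a" using Cu C by (simp add: rotate_edge_def)
  obtain p b where p: "a = p @ [b]" using a(1) by (cases a rule: rev_cases) auto
  consider "a = u" | "p = u" "b" | "p = u @ [False]" "\<not> b" | "p = u @ [False]" "b"
    | "a \<noteq> u" "p \<noteq> u" "p \<noteq> u @ [False]"
    using a p by (cases b) auto
  then have "C' (butlast (rotate_edge u a)) = C (butlast a) \<and> rotate_edge u a \<noteq> []"
  proof cases
    case 1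
    then have "rotate_word u p = p" using p by (intro rotate_word_simps(6)) auto
    then show ?thesis using 1 p C[of p] by (auto simp: rotate_edge_def)
  next
    case 2
    then have "rotate_edge u a = u @ [True, True]"
      using p rotate_word_simps(5)[of u "[]"] by (simp add: rotate_edge_def)
    then show ?thesis using 2 p Cu by (simp add: butlast_append)
  next
    case 3
    then have "rotate_edge u a = u @ [False]"
      using p rotate_word_simps(3)[of u "[]"] by (simp add: rotate_edge_def)
    then show ?thesis using 3 p Cu pivots by (simp add: butlast_append)
  next
    case 4
    then have "rotate_edge u a = u @ [True, False]"
      using p rotate_word_simps(4)[of u "[]"] by (simp add: rotate_edge_def)
    then show ?thesis using 4 p Cu pivots by (simp add: butlast_append)
  next
    case 5
    then have "rotate_edge u a = rotate_word u p @ [b]"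
      using p rotate_word_snoc by (simp add: rotate_edge_def)
    then show ?thesis using p C by simp
  qed
  then show "C' (butlast (rotate_edge u a)) = C (butlast a)" "rotate_edge u a \<noteq> []" by auto
qed

text \<open>
  The leaf numbers in \<open>N\<close> are those cut off by an inner edge whose two ends lie in different
  classes.
\<close>

definition separated :: "vertex set \<Rightarrow> (word \<Rightarrow> bool) \<Rightarrow> nat set \<Rightarrow> bool" where
  "separated S C N \<longleftrightarrow>
     (\<exists>a \<in> internal S - {[]}. C a \<noteq> C (butlast a) \<and> leaf_numbers_below S a = N)"

text \<open>
  An edge with different classes at its ends is not the flipped one, in \<open>S\<close> as well as in
  \<open>S'\<close>, so \<open>rotate_edge\<close> matches the separating edges of the two trees.
\<close>

lemma separated_rotated:
  assumes r: "rotated u S S'"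
    and C: "\<And>v. C' (rotate_word u v) = C v" and pivots: "C u = C (u @ [False])"
  shows "separated S' C' N \<longleftrightarrow> separated S C N"
proof -
  have Cu: "C' u = C' (u @ [True])"
    using C[of u] C[of "u @ [False]"] pivots by simp
  have int: "rotate_edge u a \<in> internal S' \<longleftrightarrow> a \<in> internal S" for a
    using rotated_internal[OF r] rotated_pivots[OF r] by (simp add: rotate_edge_def)
  note tr = rotate_edge_classes[of C' u C, OF C pivots] rotated_leaf_numbers_below[OF r] int
  show ?thesis
  proof
    assume "separated S C N"
    then obtain a where a: "a \<in> internal S" "a \<noteq> []" "C a \<noteq> C (butlast a)"
      "leaf_numbers_below S a = N" unfolding separated_def by blast
    moreover have "a \<noteq> u @ [False]" using a pivots by auto
    ultimately have "rotate_edge u a \<in> internal S' - {[]}"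
      "C' (rotate_edge u a) \<noteq> C' (butlast (rotate_edge u a))"
      "leaf_numbers_below S' (rotate_edge u a) = N" using tr by auto
    then show "separated S' C' N" unfolding separated_def by blast
  next
    assume "separated S' C' N"
    then obtain a' where a': "a' \<in> internal S'" "a' \<noteq> []" "C' a' \<noteq> C' (butlast a')"
      "leaf_numbers_below S' a' = N" unfolding separated_def by blast
    moreover have "a' \<noteq> u @ [True]" using a' Cu by auto
    ultimately obtain a where "a \<noteq> u @ [False]" "a \<noteq> []" "a' = rotate_edge u a"
      using rotate_edge_surj by blast
    then have "a \<in> internal S - {[]}" "C a \<noteq> C (butlast a)" "leaf_numbers_below S a = N"
      using tr a' by auto
    then show "separated S C N" unfolding separated_def by blast
  qed
qed

text \<open>
  A class function is carried along with the vertices, so that after the rotation the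
  class of a vertex is the class of its preimage. The hypothesis on the pivots is what
  constancy along the new edge of the signed graph provides.
\<close>

lemma separated_rotate_tree:
  assumes S: "finite_binary_tree S" and r: "applies r S"
  shows "finite_binary_tree (rotate_tree S r)"
    and "W ` internal (rotate_tree S r) = rot_perm r ` W ` internal S"
    and "C (W (fst (pivots r))) = C (W (snd (pivots r))) \<Longrightarrow>
      separated (rotate_tree S r) (\<lambda>v. C (inv (rot_perm r) (W v))) N
        \<longleftrightarrow> separated S (\<lambda>v. C (W v)) N"
proof -
  have "finite_binary_tree (rotate_tree S r) \<and>
    W ` internal (rotate_tree S r) = rot_perm r ` W ` internal S \<and>
    (C (W (fst (pivots r))) = C (W (snd (pivots r))) \<longrightarrow>
      separated (rotate_tree S r) (\<lambda>v. C (inv (rot_perm r) (W v))) N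
        \<longleftrightarrow> separated S (\<lambda>v. C (W v)) N)"
  proof (cases r)
    case (Fwd u)
    then have rot: "rotated u S (rotate_tree S r)"
      using rotated_forward[OF S] r by (simp add: applies_def rotate_tree_def)
    have "internal (rotate_tree S r) = rotate_word u ` internal S"
      using rotated_internal[OF rot] by (rule rotate_word_image)
    then have "W ` internal (rotate_tree S r) = rot_perm r ` W ` internal S"
      by (simp add: Fwd image_image rotation_at_W del: rotation_at.simps)
    moreover have "separated (rotate_tree S r) (\<lambda>v. C (inv (rot_perm r) (W v))) N
        \<longleftrightarrow> separated S (\<lambda>v. C (W v)) N" if "C (W (fst (pivots r))) = C (W (snd (pivots r)))"
      by (rule separated_rotated[OF rot])
        (use that in \<open>simp_all add: Fwd bij_rotation_at bij_is_inj del: rotation_at.simps flip: rotation_at_W\<close>)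
    ultimately show ?thesis using rotated_trees[OF rot] by blast
  next
    case (Bwd u)
    then have rot: "rotated u (rotate_tree S r) S"
      using rotated_backward[OF S] r by (simp add: applies_def rotate_tree_def)
    have "internal S = rotate_word u ` internal (rotate_tree S r)"
      using rotated_internal[OF rot] by (rule rotate_word_image)
    then have "W ` internal S = rotation_at u ` W ` internal (rotate_tree S r)"
      by (simp add: image_image rotation_at_W del: rotation_at.simps)
    then have "W ` internal (rotate_tree S r) = rot_perm r ` W ` internal S"
      by (simp add: Bwd bij_rotation_at bij_is_inj image_inv_f_f)
    moreover have "separated (rotate_tree S r) (\<lambda>v. C (inv (rot_perm r) (W v))) N
        \<longleftrightarrow> separated S (\<lambda>v. C (W v)) N" if "C (W (fst (pivots r))) = C (W (snd (pivots r)))"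
      by (rule separated_rotated[OF rot, symmetric])
        (use that in \<open>simp_all add: Bwd bij_rotation_at inv_inv_eq rotation_at_W del: rotation_at.simps\<close>)
    ultimately show ?thesis using rotated_trees[OF rot] by blast
  qed
  then show "finite_binary_tree (rotate_tree S r)"
    "W ` internal (rotate_tree S r) = rot_perm r ` W ` internal S"
    "C (W (fst (pivots r))) = C (W (snd (pivots r))) \<Longrightarrow>
      separated (rotate_tree S r) (\<lambda>v. C (inv (rot_perm r) (W v))) N
        \<longleftrightarrow> separated S (\<lambda>v. C (W v)) N" by auto
qed


section \<open>Classes that are constant along the signed graph\<close>

lemma bij_rot_perm: "bij (rot_perm r)"
  by (cases r) (simp_all add: bij_rotation_at bij_imp_bij_inv)

text \<open>
  The edges of the signed graph are recorded at the vertices of the initial tree, while each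
  rotation acts on the current one. Transporting the classes by the permutation of the path
  so far makes the two ends of the new edge the pivots of the next rotation.
\<close>

lemma path_invariant:
  assumes T: "finite_binary_tree T"
    and app: "\<forall>i < length w. applies (w ! i) (endpoint T (take i w))"
    and i: "i \<le> length w"
  defines "p \<equiv> \<lambda>i. path_perm (take i w)" and "S \<equiv> \<lambda>i. endpoint T (take i w)"
  shows "finite_binary_tree (S i) \<and> bij (p i) \<and> W ` internal (S i) = p i ` W ` internal T \<and>
    (\<forall>e \<in> set (sigma_upto w i). \<exists>a \<in> internal T. \<exists>b \<in> internal T. ends e = {W a, W b}) \<and>
    ((\<forall>e \<in> set (sigma_upto w i). \<forall>x y. ends e = {x, y} \<longrightarrow> C x = C y) \<longrightarrow>
      (separated (S i) (\<lambda>v. C (inv (p i) (W v))) N \<longleftrightarrow> separated T (\<lambda>v. C (W v)) N))"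
  using i
proof (induction i)
  case 0
  then show ?case using T by (simp add: p_def S_def endpoint_def path_perm_def bij_id[unfolded id_def])
next
  case (Suc i)
  let ?r = "w ! i"
  have IH: "finite_binary_tree (S i)" "bij (p i)" "W ` internal (S i) = p i ` W ` internal T"
    "\<forall>e \<in> set (sigma_upto w i). \<exists>a \<in> internal T. \<exists>b \<in> internal T. ends e = {W a, W b}"
    "(\<forall>e \<in> set (sigma_upto w i). \<forall>x y. ends e = {x, y} \<longrightarrow> C x = C y) \<Longrightarrow>
      (separated (S i) (\<lambda>v. C (inv (p i) (W v))) N \<longleftrightarrow> separated T (\<lambda>v. C (W v)) N)"
    using Suc by auto
  have ap: "applies ?r (S i)" using app Suc.prems by (simp add: S_def)
  have S: "S (Suc i) = rotate_tree (S i) ?r" and p: "p (Suc i) = rot_perm ?r \<circ> p i"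
    using Suc.prems by (simp_all add: S_def p_def take_Suc_conv_app_nth endpoint_def path_perm_def)
  note step = separated_rotate_tree[OF IH(1) ap]
  define s where "s = inv (p i) (W (fst (pivots ?r)))"
  define t where "t = inv (p i) (W (snd (pivots ?r)))"
  have e: "ends (new_edge (sigma_upto w i) (p i) ?r) = {s, t}"
    by (simp add: new_edge_def Let_def s_def t_def)
  have "inv (p i) (W v) \<in> W ` internal T" if "v \<in> internal (S i)" for v
    using IH(2,3) that by (metis bij_is_inj image_eqI image_inv_f_f)
  then have st: "s \<in> W ` internal T" "t \<in> W ` internal T"
    using ap by (auto simp: s_def t_def applies_def)
  have ip: "inv (p (Suc i)) x = inv (p i) (inv (rot_perm ?r) x)" for x
    using IH(2) bij_rot_perm by (simp add: p o_inv_distrib)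
  have sep: "separated (S (Suc i)) (\<lambda>v. C (inv (p (Suc i)) (W v))) N \<longleftrightarrow> separated T (\<lambda>v. C (W v)) N"
    if "\<forall>e \<in> set (sigma_upto w (Suc i)). \<forall>x y. ends e = {x, y} \<longrightarrow> C x = C y"
  proof -
    have "C s = C t" using that e by (simp add: p_def)
    then show ?thesis
      using step(3)[of "\<lambda>x. C (inv (p i) x)" N] IH(5) that by (simp add: S ip s_def t_def)
  qed
  have "bij (p (Suc i))" unfolding p using IH(2) bij_rot_perm by (rule bij_comp)
  moreover have "W ` internal (S (Suc i)) = p (Suc i) ` W ` internal T"
    using step(2) IH(3) by (simp add: S p image_comp)
  moreover have "\<forall>e \<in> set (sigma_upto w (Suc i)). \<exists>a \<in> internal T. \<exists>b \<in> internal T. ends e = {W a, W b}"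
    using IH(4) e st by (auto simp: p_def)
  ultimately show ?case using step(1) sep by (simp add: S)
qed

lemma internal_prefix:
  assumes "finite_binary_tree T" "u \<in> internal T" "prefix v u"
  shows "v \<in> internal T"
proof -
  obtain x where x: "u = v @ x" using assms(3) by (auto simp: prefix_def)
  show ?thesis
  proof (cases x)
    case Nil
    then show ?thesis using assms x by simp
  next
    case (Cons b y)
    then have "W ((v @ [b]) @ y) \<in> T" using assms x by (simp add: internal_def)
    then show ?thesis using tree_prefix[OF assms(1)] tree_children[OF assms(1)] by blast
  qed
qed

text \<open>
  If the class changed somewhere in \<open>T\<close>, it would change along some inner edge. The leaf
  numbers cut off there would also be cut off by an inner edge of the endpoint, against primality.
\<close>

lemma class_constant:
  fixes C :: "vertex \<Rightarrow> bool"
  assumes path: "edge_path d T w" and prime: "prime_pair T (endpoint T w)"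
    and C: "\<And>e x y. e \<in> set (sigma w) \<Longrightarrow> ends e = {x, y} \<Longrightarrow> C x = C y"
    and u: "u \<in> internal T"
  shows "C (W u) = C (W [])"
proof -
  have T: "finite_binary_tree T" and R: "finite_binary_tree (endpoint T w)"
    using prime unfolding prime_pair_def by auto
  have "\<not> separated T (\<lambda>v. C (W v)) N" for N
  proof
    assume sep: "separated T (\<lambda>v. C (W v)) N"
    have "\<forall>e \<in> set (sigma_upto w (length w)). \<forall>x y. ends e = {x, y} \<longrightarrow> C x = C y"
      using C unfolding sigma_def by blast
    moreover have "\<forall>i < length w. applies (w ! i) (endpoint T (take i w))"
      using path unfolding edge_path_def by blast
    ultimately have "separated (endpoint T w) (\<lambda>v. C (inv (path_perm w) (W v))) N"
      using path_invariant[OF T, of w "length w" C N] sep unfolding take_all[OF order.refl] by blast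
    then obtain b where "b \<in> internal (endpoint T w) - {[]}" "leaf_numbers_below (endpoint T w) b = N"
      unfolding separated_def by blast
    moreover obtain a where "a \<in> internal T - {[]}" "leaf_numbers_below T a = N"
      using sep unfolding separated_def by blast
    ultimately show False using prime unfolding prime_pair_iff_leaf_numbers by blast
  qed
  then have "\<not> separated T (\<lambda>v. C (W v)) (leaf_numbers_below T a)" for a .
  then have eq: "C (W a) = C (W (butlast a))" if "a \<in> internal T" "a \<noteq> []" for a
    using that unfolding separated_def by blast
  show ?thesis using u
  proof (induction u rule: rev_induct)
    case Nil
    then show ?case by simp
  next
    case (snoc b u)
    have "u \<in> internal T" using internal_prefix[OF T snoc.prems, of u] by simp
    then have "C (W u) = C (W [])" by (rule snoc.IH)
    with eq[OF snoc.prems] show ?case by simp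
  qed
qed

section \<open>Balanced signed graphs and the coloring\<close>

abbreviation negatives :: "signed_edge list \<Rightarrow> nat" where
  "negatives es \<equiv> length (filter (\<lambda>e. \<not> positive e) es)"

lemma walk_append: "walk G x es y \<Longrightarrow> walk G y fs z \<Longrightarrow> walk G x (es @ fs) z"
  by (induction rule: walk.induct) (auto intro: walk.intros)

lemma walk_edge: "e \<in> set G \<Longrightarrow> ends e = {x, y} \<Longrightarrow> walk G x [e] y"
  by (auto intro: walk.intros)

lemma walk_rev: "walk G x es y \<Longrightarrow> walk G y (rev es) x"
proof (induction rule: walk.induct)
  case (walk_Nil x)
  show ?case by (simp add: walk.walk_Nil)
next
  case (walk_Cons e x y es z)
  then have "walk G y [e] x" by (intro walk_edge) auto
  with walk_Cons show ?case by (simp add: walk_append)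
qed

lemma negatives_rev [simp]: "negatives (rev es) = negatives es"
  by (simp add: rev_filter[symmetric])

text \<open>One of the walks followed by the other one backwards is closed.\<close>

lemma balanced_parity:
  assumes "balanced G" "walk G x es y" "walk G x fs y"
  shows "even (negatives es) \<longleftrightarrow> even (negatives fs)"
proof -
  have "walk G x (es @ rev fs) x" using assms walk_append walk_rev by blast
  then have "even (negatives (es @ rev fs))" using assms(1) unfolding balanced_def by blast
  then show ?thesis by simp
qed

theorem corollary11p5p1:
  fixes d :: nat and T :: "vertex set" and w :: "rotation list"
  assumes "edge_path d T w"
    and "sign_consistent w"
    and "prime_pair T (endpoint T w)"
  shows "\<exists>!c. coloring T c \<and> normal c \<and> compatible T c (sigma w) \<and> sign_positive c []"
proof -
  let ?G = "sigma w"
  have T: "finite_binary_tree T" using assms(3) unfolding prime_pair_def by auto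
  have root: "[] \<in> internal T"
  proof -
    have "\<not> leaves T \<subseteq> {[]}"
    proof
      assume "leaves T \<subseteq> {[]}"
      then have "card (leaves T) \<le> card {[] :: word}" by (intro card_mono) auto
      then show False using assms(3) by (simp add: prime_pair_def)
    qed
    then obtain v where v: "v \<in> leaves T" "v \<noteq> []" by blast
    then obtain b x where "v = b # x" by (cases v) auto
    with v(1) have "W ([b] @ x) \<in> T" by (simp add: leaves_def)
    then have "W ([] @ [b]) \<in> T" using tree_prefix[OF T] by simp
    then show ?thesis using tree_children[OF T] by blast
  qed
  have ends_internal: "\<exists>a \<in> internal T. \<exists>b \<in> internal T. ends e = {W a, W b}"
    if "e \<in> set ?G" for e
    using path_invariant[OF T, of w "length w"] assms(1) that
    by (simp add: edge_path_def sigma_def)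
  have compatible_iff: "compatible T c ?G \<longleftrightarrow>
    (\<forall>e \<in> set ?G. \<forall>a b. ends e = {W a, W b} \<longrightarrow>
       (positive e \<longleftrightarrow> (sign_positive c a \<longleftrightarrow> sign_positive c b)))" for c
    unfolding compatible_def
  proof (rule ball_cong[OF refl])
    fix e assume "e \<in> set ?G"
    then obtain a b where ab: "a \<in> internal T" "b \<in> internal T" "ends e = {W a, W b}"
      using ends_internal by blast
    let ?same = "sign_positive c a \<longleftrightarrow> sign_positive c b"
    have "(\<exists>u \<in> internal T. \<exists>v \<in> internal T. ends e = {W u, W v} \<and>
        (sign_positive c u \<longleftrightarrow> sign_positive c v)) \<longleftrightarrow> ?same"
      using ab by (auto simp: doubleton_eq_iff)
    moreover have "(\<forall>u v. ends e = {W u, W v} \<longrightarrow>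
        (positive e \<longleftrightarrow> (sign_positive c u \<longleftrightarrow> sign_positive c v))) \<longleftrightarrow> (positive e \<longleftrightarrow> ?same)"
      using ab by (auto simp: doubleton_eq_iff)
    ultimately show "(positive e \<longleftrightarrow> (\<exists>u \<in> internal T. \<exists>v \<in> internal T. ends e = {W u, W v} \<and>
          (sign_positive c u \<longleftrightarrow> sign_positive c v))) \<longleftrightarrow>
        (\<forall>u v. ends e = {W u, W v} \<longrightarrow>
          (positive e \<longleftrightarrow> (sign_positive c u \<longleftrightarrow> sign_positive c v)))"
      by simp
  qed
  have same_class: "C (W u) = C (W [])"
    if "\<And>e a b. e \<in> set ?G \<Longrightarrow> ends e = {W a, W b} \<Longrightarrow> C (W a) = C (W b)" "u \<in> internal T" for C :: "vertex \<Rightarrow> bool" and u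
  proof (rule class_constant[OF assms(1,3) _ that(2)])
    fix e x y assume e: "e \<in> set ?G" "ends e = {x, y}"
    then obtain a b where xy: "x = W a" "y = W b"
      using ends_internal[OF e(1)] by (auto simp: doubleton_eq_iff)
    show "C x = C y" unfolding xy by (rule that(1)[OF e(1)]) (use e(2) xy in simp)
  qed

  \<comment> \<open>Some parity of walks exists at every internal vertex, as reachability from \<open>W []\<close> does
    not change along edges; balance makes the parity independent of the walk.\<close>
  define s where "s u \<longleftrightarrow> (\<exists>es. walk ?G (W []) es (W u) \<and> even (negatives es))" for u
  have reach: "\<exists>es. walk ?G (W []) es (W u)" if "u \<in> internal T" for u
  proof -
    have "(\<exists>es. walk ?G (W []) es (W a)) \<longleftrightarrow> (\<exists>es. walk ?G (W []) es (W b))"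
      if "e \<in> set ?G" "ends e = {W a, W b}" for e a b
    proof -
      have "walk ?G (W a) [e] (W b)" "walk ?G (W b) [e] (W a)"
        using that by (auto intro!: walk_edge)
      then show ?thesis using walk_append by blast
    qed
    then have "(\<exists>es. walk ?G (W []) es (W u)) \<longleftrightarrow> (\<exists>es. walk ?G (W []) es (W []))"
      using that by (rule same_class[where C = "\<lambda>x. \<exists>es. walk ?G (W []) es x"])
    then show ?thesis using walk_Nil by blast
  qed
  have bal: "balanced ?G" using assms(2) by (simp add: sign_consistent_def)
  have s_walk: "s u \<longleftrightarrow> even (negatives es)" if "walk ?G (W []) es (W u)" for u es
    using balanced_parity[OF bal that] that unfolding s_def by blast
  define c where "c = color_of_signs T s"
  note c = color_of_signs[OF T, where s = s, folded c_def]
  have "compatible T c ?G" unfolding compatible_iff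
  proof (intro ballI allI impI)
    fix e a b assume e: "e \<in> set ?G" "ends e = {W a, W b}"
    then have ab: "a \<in> internal T" "b \<in> internal T"
      using ends_internal[OF e(1)] by (auto simp: doubleton_eq_iff)
    obtain es where es: "walk ?G (W []) es (W a)" using reach ab by blast
    have "walk ?G (W []) (es @ [e]) (W b)" using es e walk_append walk_edge by blast
    then have "s b \<longleftrightarrow> even (negatives (es @ [e]))" by (rule s_walk)
    then show "positive e \<longleftrightarrow> (sign_positive c a \<longleftrightarrow> sign_positive c b)"
      using s_walk[OF es] c(3) ab by auto
  qed
  moreover have "sign_positive c []"
    using c(3)[OF root] s_walk[OF walk_Nil] by simp
  ultimately have ex: "coloring T c \<and> normal c \<and> compatible T c ?G \<and> sign_positive c []"
    using c by blast
  show ?thesis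
  proof (rule ex1I[where a = c])
    show "coloring T c \<and> normal c \<and> compatible T c ?G \<and> sign_positive c []" by (fact ex)
  next
    fix c' assume c': "coloring T c' \<and> normal c' \<and> compatible T c' ?G \<and> sign_positive c' []"
    \<comment> \<open>Both colorings fulfil the same condition at each edge, so their signs agree at both
      of its ends or at neither.\<close>
    let ?agree = "\<lambda>u. sign_positive c' u = sign_positive c u"
    have "?agree u" if "u \<in> internal T" for u
    proof -
      have "?agree a = ?agree b" if "e \<in> set ?G" "ends e = {W a, W b}" for e a b
        using c' ex that unfolding compatible_iff by blast
      then have "?agree u = ?agree []"
        using same_class[where C = "\<lambda>x. case x of W v \<Rightarrow> ?agree v | Star \<Rightarrow> True", OF _ that]
        unfolding vertex.case by blast
      then show ?thesis using c' ex by simp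
    qed
    then show "c' = c" using coloring_unique[OF T] c' ex by blast
  qed
qed

end
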